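(* Let $R,\rho,\nu,C_0,W,P_t,K,\bar g,I,\gamma$ be positive real constants, let $C\subset\mathbf{R}^2$ be the disc of radius $R$ centered at the origin (the cell), and let $\Phi$ be a Poisson point process on $C$ with intensity measure $d\Lambda(x)=\frac{\rho}{\nu}\,dx$. For $x\in C\setminus\{0\}$ let $$N(x)=\left\lceil \frac{C_0}{W\log_2\left(1+\dfrac{P_tK\bar g}{I\|x\|^{\gamma}}\right)}\right\rceil,$$ and let $N_{max}$ be the value of $N$ at points of the cell boundary $\|x\|=R$. Put $R_0=0$ and $$R_j=\left(\frac{P_tK\bar g}{I(2^{C_0/(jW)}-1)}\right)^{1/\gamma}\qquad (j=1,\dots,N_{max}).$$ Then, as a function of $\|x\|$, $N$ is increasing and piecewise constant, with $N(x)=j$ for $R_{j-1}<\|x\|\le R_j$. Moreover, $$\mathbf{E}\left[\int N\,d\Phi\right]=\int N\,d\Lambda=m_N:=\frac{\pi\rho}{\nu}\sum_{j=1}^{N_{max}}j\,(R_j^2-R_{j-1}^2),$$ $$\int N^2\,d\Lambda=v_N:=\frac{\pi\rho}{\nu}\sum_{j=1}^{N_{max}}j^2\,(R_j^2-R_{j-1}^2),$$ and for every real $\alpha\ge 1$, $$\mathbf{P}\left(\int N\,d\Phi\ge\alpha m_N\right)\le \exp\left(-\frac{v_N}{N_{max}^2}\; g\!\left(\frac{(\alpha-1)\,m_N\,N_{max}}{v_N}\right)\right),$$ where $g(t)=(1+t)\ln(1+t)-t$.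
   Context: $\lceil\cdot\rceil$ is the ceiling function, $\|\cdot\|$ the Euclidean norm, and $\int N\,d\Phi=\sum_{X\in\Phi}N(X)$ is the sum of $N$ over the points of $\Phi$ (the value of $N$ at the single point $0$ is irrelevant, as $\Lambda(\{0\})=0$). A Poisson process of intensity $\Lambda$ is a random locally finite set of points whose number of points in each compact set $A$ is Poisson distributed with parameter $\Lambda(A)$ and whose numbers of points in disjoint sets are independent.
   Formalization: The identities for ∫N dΛ and ∫N² dΛ fail when R_{N_max} > R; they are proved with R_{N_max} replaced by R in m_N and v_N, and as printed when R_{N_max} = R. The deviation bound is proved both for these corrected values and for the printed m_N, v_N. *)

theory Defs
  imports "HOL-Probability.Probability"
begin

text \<open>
  The number of points of a point configuration \<open>X\<close> in a region \<open>A\<close>, with values in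
  \<open>[0, \<infinity>]\<close> (\<open>card\<close> would return \<open>0\<close> when there are infinitely many points).
\<close>

definition point_count :: "'a set \<Rightarrow> 'a set \<Rightarrow> ennreal" where
  "point_count X A = emeasure (count_space UNIV) (X \<inter> A)"

text \<open>
  The state space of the process is the underlying space of its intensity measure \<open>\<Lambda>\<close>.
  The Poisson probabilities are written out because \<open>poisson_pmf\<close> is unspecified at rate
  \<open>0\<close>, whereas null sets of \<open>\<Lambda>\<close> must be covered; here \<open>0 ^ 0 = 1\<close>, so a null compact set
  almost surely contains no point.  Independence for finitely many disjoint sets is the case
  where all but finitely many members of the family are empty.
\<close>

definition poisson_process ::
  "'w measure \<Rightarrow> 'a::topological_space measure \<Rightarrow> ('w \<Rightarrow> 'a set) \<Rightarrow> bool" where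
  "poisson_process M \<Lambda> \<Phi> \<longleftrightarrow>
     prob_space M \<and>
     (\<forall>\<omega>\<in>space M. \<Phi> \<omega> \<subseteq> space \<Lambda>) \<and>
     (\<forall>\<omega>\<in>space M. \<forall>A\<in>sets \<Lambda>. compact A \<longrightarrow> finite (\<Phi> \<omega> \<inter> A)) \<and>
     (\<forall>A\<in>sets \<Lambda>. (\<lambda>\<omega>. point_count (\<Phi> \<omega>) A) \<in> borel_measurable M) \<and>
     (\<forall>A\<in>sets \<Lambda>. compact A \<longrightarrow> emeasure \<Lambda> A < \<infinity> \<and>
        (\<forall>n::nat. measure M {\<omega>\<in>space M. point_count (\<Phi> \<omega>) A = of_nat n}
                    = exp (- measure \<Lambda> A) * measure \<Lambda> A ^ n / fact n)) \<and>
     (\<forall>A::nat \<Rightarrow> 'a set. range A \<subseteq> sets \<Lambda> \<longrightarrow> disjoint_family A \<longrightarrow>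
        prob_space.indep_vars M (\<lambda>_. borel) (\<lambda>i \<omega>. point_count (\<Phi> \<omega>) (A i)) UNIV)"

definition m_N :: "real \<Rightarrow> real \<Rightarrow> nat \<Rightarrow> (nat \<Rightarrow> real) \<Rightarrow> real" where
  "m_N \<rho> \<nu> n r = pi * \<rho> / \<nu> * (\<Sum>j = 1..n. real j * ((r j)\<^sup>2 - (r (j - 1))\<^sup>2))"

definition v_N :: "real \<Rightarrow> real \<Rightarrow> nat \<Rightarrow> (nat \<Rightarrow> real) \<Rightarrow> real" where
  "v_N \<rho> \<nu> n r = pi * \<rho> / \<nu> * (\<Sum>j = 1..n. (real j)\<^sup>2 * ((r j)\<^sup>2 - (r (j - 1))\<^sup>2))"

text \<open>
  The outermost ring \<open>R\<^sub>n\<^sub>-\<^sub>1 < \<parallel>x\<parallel> \<le> R\<^sub>n\<close> (with \<open>n = N\<^sub>m\<^sub>a\<^sub>x\<close>) is cut by the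
  cell boundary, as in general only \<open>R\<^sub>n\<^sub>-\<^sub>1 < R \<le> R\<^sub>n\<close>.  Integrals over the cell therefore
  involve the radii \<open>min R\<^sub>j R\<close>: these are the \<open>R\<^sub>j\<close> for \<open>j < n\<close>, and \<open>R\<close> for \<open>j = n\<close>.
\<close>

definition capped :: "real \<Rightarrow> (nat \<Rightarrow> real) \<Rightarrow> nat \<Rightarrow> real" where
  "capped R r j = min (r j) R"

definition g_fun :: "real \<Rightarrow> real" where
  "g_fun t = (1 + t) * ln (1 + t) - t"

definition deviation_bound :: "real \<Rightarrow> real \<Rightarrow> real \<Rightarrow> real \<Rightarrow> real" where
  "deviation_bound m v b \<alpha> = exp (- (v / b\<^sup>2) * g_fun ((\<alpha> - 1) * m * b / v))"

end

theory Submission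
  imports Defs
begin

text \<open>
  \<open>N\<close> takes the value \<open>j\<close> on the ring between the balls of radii \<open>R\<^sub>j\<^sub>-\<^sub>1\<close> and \<open>R\<^sub>j\<close>, so
  \<open>\<integral>N d\<Phi>\<close> is the sum of the numbers of points in the rings weighted by \<open>j\<close>.  These numbers
  are independent, and the moment generating function of the one in a ring \<open>B - A\<close> is
  \<open>exp (\<Lambda> (B - A) (e\<^sup>\<theta> - 1))\<close>.  The Poisson law is only given for compact sets, but the
  numbers of points in \<open>A\<close> and \<open>B - A\<close> are independent and add up to that of \<open>B\<close>, so the
  function for \<open>B - A\<close> is the quotient of those for the compact balls \<open>B\<close> and \<open>A\<close>.  The tail
  bound is Bennett's: bound \<open>e\<^sup>\<theta>\<^sup>j - 1 - \<theta>j\<close> by \<open>(j / n)\<^sup>2 (e\<^sup>\<theta>\<^sup>n - 1 - \<theta>n)\<close> and optimise over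
  \<open>\<theta>\<close> in Chernoff's inequality.  It only needs an upper bound for the Laplace transform, so
  it also holds with the larger masses of the rings that are not cut by the cell boundary.
\<close>

section \<open>Bennett's tail bound from a bound on the Laplace transform\<close>

text \<open>Termwise comparison of the power series from degree 2 on: there
  \<open>c ^ (k + 2)\<close> is at most \<open>c ^ 2\<close>, and the powers of \<open>y\<close> are
  nonnegative.\<close>

lemma exp_minus_linear_le_scaled:
  fixes c y :: real
  assumes "0 \<le> c" "c \<le> 1" "0 \<le> y"
  shows "exp (c * y) - 1 - c * y \<le> c\<^sup>2 * (exp y - 1 - y)"
proof -
  have s: "(\<lambda>k. z ^ (k + 2) / fact (k + 2)) sums (exp z - 1 - z)" for z :: real
  proof -
    have "(\<lambda>k. z ^ k / fact k) sums exp z"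
      using exp_converges[of z] by (simp add: divide_inverse mult.commute)
    from sums_split_initial_segment[OF this, of 2] show ?thesis
      by (simp add: numeral_2_eq_2 algebra_simps)
  qed
  have "(c * y) ^ (k + 2) / fact (k + 2) \<le> c\<^sup>2 * (y ^ (k + 2) / fact (k + 2))" for k
  proof -
    have "c ^ k \<le> 1"
      using assms by (intro power_le_one)
    then have "(c * y) ^ (k + 2) \<le> c\<^sup>2 * y ^ (k + 2)"
      using assms mult_right_mono[of "c ^ k" 1 "c\<^sup>2 * y ^ (k + 2)"]
      by (simp add: power_mult_distrib power_add power2_eq_square ac_simps)
    then show ?thesis
      by (simp add: divide_right_mono)
  qed
  with sums_le[OF _ s sums_mult[OF s]] show ?thesis
    by blast
qed

text \<open>The bound in \<open>mgf\<close> is the transform of a compound Poisson variable with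
  rate \<open>l j\<close> for jumps of size \<open>j\<close>, and \<open>m\<close> and
  \<open>v\<close> are the mean and variance of that variable. The transform of \<open>X\<close> may
  be smaller, so the rates may overestimate the true masses.\<close>

lemma (in prob_space) bennett_tail:
  fixes X :: "'a \<Rightarrow> real" and l :: "nat \<Rightarrow> real" and n :: nat
  assumes X[measurable]: "X \<in> borel_measurable M"
    and mgf: "\<And>\<theta>. \<theta> \<ge> 0 \<Longrightarrow> (\<integral>\<^sup>+\<omega>. ennreal (exp (\<theta> * X \<omega>)) \<partial>M)
                 \<le> ennreal (exp (\<Sum>j=1..n. l j * (exp (\<theta> * real j) - 1)))"
    and l: "\<And>j. j \<in> {1..n} \<Longrightarrow> l j \<ge> 0"
    and m: "m = (\<Sum>j=1..n. real j * l j)" "m > 0"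
    and v: "v = (\<Sum>j=1..n. (real j)\<^sup>2 * l j)" "v > 0"
    and n: "n > 0" and \<alpha>: "\<alpha> \<ge> 1"
  shows "prob {\<omega>\<in>space M. X \<omega> \<ge> \<alpha> * m} \<le> deviation_bound m v (real n) \<alpha>"
proof -
  define t where "t = (\<alpha> - 1) * m * real n / v"
  have t: "t \<ge> 0"
    using \<alpha> m v n by (simp add: t_def)
  \<comment> \<open>the minimiser of the Chernoff exponent \<open>v / n\<^sup>2 (e\<^sup>\<theta>\<^sup>n - 1 - \<theta>n) - \<theta>(\<alpha> - 1)m\<close>\<close>
  define \<theta> where "\<theta> = ln (1 + t) / real n"
  have \<theta>: "\<theta> \<ge> 0" "exp (\<theta> * real n) = 1 + t" "\<theta> * real n = ln (1 + t)"
    using t n by (simp_all add: \<theta>_def)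
  \<comment> \<open>Subtracting \<open>\<theta> * m\<close> supplies each summand with its linear
    term, so that \<open>exp_minus_linear_le_scaled\<close> applies with \<open>c = j / n\<close>
    and \<open>y = \<theta> * n\<close>.\<close>
  have "(\<Sum>j=1..n. l j * (exp (\<theta> * real j) - 1)) - \<theta> * m
      = (\<Sum>j=1..n. l j * (exp (\<theta> * real j) - 1 - \<theta> * real j))"
    by (simp add: m sum_distrib_left algebra_simps flip: sum_subtractf)
  also have "\<dots> \<le> (\<Sum>j=1..n. l j * ((real j / real n)\<^sup>2 * (exp (\<theta> * real n) - 1 - \<theta> * real n)))"
  proof (intro sum_mono mult_left_mono l)
    fix j assume j: "j \<in> {1..n}"
    have "real j / real n * (\<theta> * real n) = \<theta> * real j"
      using n by simp
    with exp_minus_linear_le_scaled[of "real j / real n" "\<theta> * real n"] j n \<theta>(1)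
    show "exp (\<theta> * real j) - 1 - \<theta> * real j
        \<le> (real j / real n)\<^sup>2 * (exp (\<theta> * real n) - 1 - \<theta> * real n)"
      by (simp only:) simp
  qed
  also have "\<dots> = v / (real n)\<^sup>2 * (t - ln (1 + t))"
    using t by (simp add: v \<theta>(3) sum_distrib_left sum_distrib_right sum_divide_distrib power_divide ac_simps)
  finally have le: "(\<Sum>j=1..n. l j * (exp (\<theta> * real j) - 1)) - \<theta> * (\<alpha> * m)
      \<le> v / (real n)\<^sup>2 * (t - ln (1 + t)) - \<theta> * ((\<alpha> - 1) * m)"
    by (simp add: algebra_simps)
  have "(\<alpha> - 1) * m = v / real n * t"
    using n v(2) by (simp add: t_def)
  \<comment> \<open>Since \<open>\<theta> = ln (1 + t) / n\<close>, the subtracted term is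
    \<open>v / n ^ 2 * (t * ln (1 + t))\<close>, and \<open>t - ln (1 + t) - t * ln (1 + t)\<close>
    is \<open>- g_fun t\<close>.\<close>
  then have opt: "v / (real n)\<^sup>2 * (t - ln (1 + t)) - \<theta> * ((\<alpha> - 1) * m) = - (v / (real n)\<^sup>2) * g_fun t"
    by (simp only: \<theta>_def g_fun_def) (simp add: power2_eq_square algebra_simps add_divide_distrib diff_divide_distrib)
  \<comment> \<open>Chernoff: as \<theta> is nonnegative, the indicator of the event is at most
    \<open>exp (\<theta> * (X \<omega> - \<alpha> * m))\<close>.\<close>
  have "emeasure M {\<omega>\<in>space M. X \<omega> \<ge> \<alpha> * m}
      \<le> (\<integral>\<^sup>+\<omega>. ennreal (exp (- \<theta> * (\<alpha> * m))) * ennreal (exp (\<theta> * X \<omega>)) \<partial>M)"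
  proof -
    have "emeasure M {\<omega>\<in>space M. X \<omega> \<ge> \<alpha> * m}
        = (\<integral>\<^sup>+\<omega>. indicator {\<omega>\<in>space M. X \<omega> \<ge> \<alpha> * m} \<omega> \<partial>M)"
      by simp
    also have "\<dots> \<le> (\<integral>\<^sup>+\<omega>. ennreal (exp (- \<theta> * (\<alpha> * m))) * ennreal (exp (\<theta> * X \<omega>)) \<partial>M)"
      using \<theta>(1)
      by (intro nn_integral_mono)
         (auto simp: indicator_def mult_left_mono simp flip: ennreal_mult ennreal_1 exp_add)
    finally show ?thesis .
  qed
  also have "\<dots> = ennreal (exp (- \<theta> * (\<alpha> * m))) * (\<integral>\<^sup>+\<omega>. ennreal (exp (\<theta> * X \<omega>)) \<partial>M)"
    by (simp add: nn_integral_cmult)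
  also have "\<dots> \<le> ennreal (exp (- \<theta> * (\<alpha> * m)))
      * ennreal (exp (\<Sum>j=1..n. l j * (exp (\<theta> * real j) - 1)))"
    by (intro mult_left_mono mgf \<theta>) simp
  also have "\<dots> = ennreal (exp ((\<Sum>j=1..n. l j * (exp (\<theta> * real j) - 1)) - \<theta> * (\<alpha> * m)))"
    by (simp add: exp_diff exp_minus divide_inverse mult.commute flip: ennreal_mult)
  also have "\<dots> \<le> ennreal (deviation_bound m v (real n) \<alpha>)"
    using le unfolding opt by (simp add: deviation_bound_def t_def)
  finally show ?thesis
    by (simp add: emeasure_eq_measure deviation_bound_def)
qed

section \<open>Counts of a Poisson process in one compact set\<close>

lemma point_count_eq_card: "finite (X \<inter> A) \<Longrightarrow> point_count X A = of_nat (card (X \<inter> A))"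
  by (simp add: point_count_def emeasure_count_space)

context
  fixes M :: "'w measure" and \<Lambda> :: "'a::topological_space measure" and \<Phi> :: "'w \<Rightarrow> 'a set"
  assumes pp: "poisson_process M \<Lambda> \<Phi>"
begin

interpretation prob_space M
  using pp by (simp add: poisson_process_def)

text \<open>\<open>enn2real\<close> sends an infinite count to \<open>0\<close>. On subsets of
  compact measurable sets the count is finite, and the value is the cardinality.\<close>

definition points_in :: "'a set \<Rightarrow> 'w \<Rightarrow> real" where
  "points_in A \<omega> = enn2real (point_count (\<Phi> \<omega>) A)"

lemma points_in_nonneg[simp]: "points_in A \<omega> \<ge> 0"
  by (simp add: points_in_def)

lemma measurable_points_in[measurable]: "A \<in> sets \<Lambda> \<Longrightarrow> points_in A \<in> borel_measurable M"
  using pp by (auto simp: poisson_process_def points_in_def[abs_def])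

lemma finite_points:
  "\<omega> \<in> space M \<Longrightarrow> B \<in> sets \<Lambda> \<Longrightarrow> compact B \<Longrightarrow> A \<subseteq> B \<Longrightarrow> finite (\<Phi> \<omega> \<inter> A)"
  using pp unfolding poisson_process_def by (meson Int_mono finite_subset order_refl)

lemma points_in_eq_card:
  "\<omega> \<in> space M \<Longrightarrow> B \<in> sets \<Lambda> \<Longrightarrow> compact B \<Longrightarrow> A \<subseteq> B \<Longrightarrow> points_in A \<omega> = card (\<Phi> \<omega> \<inter> A)"
  using finite_points by (simp add: points_in_def point_count_eq_card)

lemma indep_vars_points_in:
  assumes "range A \<subseteq> sets \<Lambda>" "disjoint_family A"
    and "\<And>i. f i \<in> borel_measurable borel"
  shows "indep_vars (\<lambda>_. borel) (\<lambda>i \<omega>. f i (points_in (A i) \<omega>)) (J :: nat set)"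
proof -
  have "indep_vars (\<lambda>_. borel) (\<lambda>i \<omega>. point_count (\<Phi> \<omega>) (A i)) J"
    using pp assms by (intro indep_vars_subset[of _ _ UNIV J]) (auto simp: poisson_process_def)
  from indep_vars_compose2[OF this, of "\<lambda>i x. f i (enn2real x)" "\<lambda>_. borel"] assms(3)
  show ?thesis
    by (simp add: points_in_def)
qed

text \<open>The count in a compact set is finite at every outcome, so the events \<open>E n\<close>
  partition the space and the integrand is constant on each.\<close>

lemma nn_integral_points_in_compact:
  fixes f :: "real \<Rightarrow> ennreal"
  assumes A: "A \<in> sets \<Lambda>" "compact A"
  shows "(\<integral>\<^sup>+\<omega>. f (points_in A \<omega>) \<partial>M)
       = (\<Sum>n. f (real n) * ennreal (exp (- measure \<Lambda> A) * measure \<Lambda> A ^ n / fact n))"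
proof -
  define E where "E n = {\<omega>\<in>space M. point_count (\<Phi> \<omega>) A = of_nat n}" for n :: nat
  have [measurable]: "(\<lambda>\<omega>. point_count (\<Phi> \<omega>) A) \<in> borel_measurable M"
    using pp A by (simp add: poisson_process_def)
  have E[measurable]: "E n \<in> sets M" for n
    unfolding E_def by measurable
  have "(\<integral>\<^sup>+\<omega>. f (points_in A \<omega>) \<partial>M) = (\<integral>\<^sup>+\<omega>. (\<Sum>n. f (real n) * indicator (E n) \<omega>) \<partial>M)"
  proof (rule nn_integral_cong)
    fix \<omega> assume \<omega>: "\<omega> \<in> space M"
    define k where "k = card (\<Phi> \<omega> \<inter> A)"
    have "(\<lambda>n. f (real n) * indicator (E n) \<omega>) = (\<lambda>n. if n = k then f (real n) else 0)"
      using \<omega> finite_points[OF \<omega> A order_refl]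
      by (auto simp: E_def k_def point_count_eq_card fun_eq_iff)
    moreover have "points_in A \<omega> = k"
      using points_in_eq_card[OF \<omega> A order_refl] by (simp add: k_def)
    ultimately show "f (points_in A \<omega>) = (\<Sum>n. f (real n) * indicator (E n) \<omega>)"
      using sums_unique[OF sums_single[of k "\<lambda>n. f (real n)"]] by simp
  qed
  also have "\<dots> = (\<Sum>n. f (real n) * emeasure M (E n))"
    by (simp add: nn_integral_suminf nn_integral_cmult)
  also have "\<dots> = (\<Sum>n. f (real n) * ennreal (exp (- measure \<Lambda> A) * measure \<Lambda> A ^ n / fact n))"
  proof -
    have "emeasure M (E n) = ennreal (exp (- measure \<Lambda> A) * measure \<Lambda> A ^ n / fact n)" for n
      using pp A by (simp add: poisson_process_def emeasure_eq_measure E_def)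
    then show ?thesis
      by simp
  qed
  finally show ?thesis .
qed

text \<open>The factor \<open>exp (\<theta> * n)\<close> merges into the \<open>n\<close>-th power
  of the Poisson weight, which leaves the exponential series at
  \<open>measure \<Lambda> A * exp \<theta>\<close>.\<close>

lemma mgf_points_in_compact:
  assumes A: "A \<in> sets \<Lambda>" "compact A"
  shows "(\<integral>\<^sup>+\<omega>. ennreal (exp (\<theta> * points_in A \<omega>)) \<partial>M) = ennreal (exp (measure \<Lambda> A * (exp \<theta> - 1)))"
proof -
  let ?l = "measure \<Lambda> A"
  have "(\<lambda>n. exp (- ?l) * (inverse (fact n) * (?l * exp \<theta>) ^ n)) sums (exp (- ?l) * exp (?l * exp \<theta>))"
    using exp_converges[of "?l * exp \<theta>"] by (intro sums_mult) simp
  then have "(\<Sum>n. ennreal (exp (- ?l) * (inverse (fact n) * (?l * exp \<theta>) ^ n)))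
      = ennreal (exp (- ?l) * exp (?l * exp \<theta>))"
    by (intro suminf_ennreal_eq) auto
  moreover have "ennreal (exp (\<theta> * real n)) * ennreal (exp (- ?l) * ?l ^ n / fact n)
      = ennreal (exp (- ?l) * (inverse (fact n) * (?l * exp \<theta>) ^ n))" for n
    by (simp add: exp_of_nat2_mult power_mult_distrib divide_inverse ac_simps flip: ennreal_mult)
  ultimately show ?thesis
    using nn_integral_points_in_compact[OF A, of "\<lambda>x. ennreal (exp (\<theta> * x))"]
    by (simp add: algebra_simps exp_diff exp_minus divide_inverse)
qed

lemma mean_points_in_compact:
  assumes A: "A \<in> sets \<Lambda>" "compact A"
  shows "(\<integral>\<^sup>+\<omega>. ennreal (points_in A \<omega>) \<partial>M) = ennreal (measure \<Lambda> A)"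
proof -
  let ?l = "measure \<Lambda> A"
  let ?f = "\<lambda>n. real n * (exp (- ?l) * ?l ^ n / fact n)"
  have "(\<lambda>n. exp (- ?l) * ?l * (inverse (fact n) * ?l ^ n)) sums (exp (- ?l) * ?l * exp ?l)"
    using exp_converges[of "?l"] by (intro sums_mult) simp
  \<comment> \<open>The term at \<open>0\<close> vanishes. In the others \<open>n / fact n\<close>
    cancels to \<open>1 / fact (n - 1)\<close>, and a factor \<open>?l\<close> comes out.\<close>
  then have "(\<lambda>n. ?f (Suc n)) sums ?l"
    by (simp add: exp_minus field_simps del: of_nat_Suc)
  from sums_Suc[OF this] have "?f sums ?l"
    by simp
  then have "(\<Sum>n. ennreal (?f n)) = ennreal ?l"
    by (intro suminf_ennreal_eq) auto
  then show ?thesis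
    using nn_integral_points_in_compact[OF A, of ennreal] by (simp flip: ennreal_mult)
qed

section \<open>Counts in a difference of two compact sets\<close>

context
  fixes A B
  assumes A: "A \<in> sets \<Lambda>" "compact A" and B: "B \<in> sets \<Lambda>" "compact B" and sub: "A \<subseteq> B"
begin

lemma points_in_split: "\<omega> \<in> space M \<Longrightarrow> points_in B \<omega> = points_in A \<omega> + points_in (B - A) \<omega>"
proof -
  assume \<omega>: "\<omega> \<in> space M"
  have "card (\<Phi> \<omega> \<inter> B) = card (\<Phi> \<omega> \<inter> A \<union> \<Phi> \<omega> \<inter> (B - A))"
    using sub by (intro arg_cong[of _ _ card]) auto
  also have "\<dots> = card (\<Phi> \<omega> \<inter> A) + card (\<Phi> \<omega> \<inter> (B - A))"
    using \<omega> B sub by (intro card_Un_disjoint finite_points) auto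
  finally show ?thesis
    using \<omega> B sub by (simp add: points_in_eq_card[of \<omega> B])
qed

lemma measure_split: "measure \<Lambda> (B - A) = measure \<Lambda> B - measure \<Lambda> A"
  using pp A B sub by (intro measure_Diff) (auto simp: poisson_process_def less_top)

lemma mgf_points_in_Diff:
  "(\<integral>\<^sup>+\<omega>. ennreal (exp (\<theta> * points_in (B - A) \<omega>)) \<partial>M) = ennreal (exp (measure \<Lambda> (B - A) * (exp \<theta> - 1)))"
proof -
  \<comment> \<open>Independence is given for sequences of sets, so the pair is padded with empty
    sets and then restricted to the indices \<open>0\<close> and \<open>1\<close>.\<close>
  let ?E = "binaryset A (B - A)"
  have "indep_vars (\<lambda>_. borel) (\<lambda>i \<omega>. ennreal (exp (\<theta> * points_in (?E i) \<omega>))) {0, 1}"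
    using A B by (intro indep_vars_points_in) (auto simp: binaryset_def disjoint_family_on_def)
  from indep_vars_nn_integral[OF _ this]
  have "(\<integral>\<^sup>+\<omega>. ennreal (exp (\<theta> * points_in A \<omega>)) * ennreal (exp (\<theta> * points_in (B - A) \<omega>)) \<partial>M)
      = (\<integral>\<^sup>+\<omega>. ennreal (exp (\<theta> * points_in A \<omega>)) \<partial>M) * (\<integral>\<^sup>+\<omega>. ennreal (exp (\<theta> * points_in (B - A) \<omega>)) \<partial>M)"
    by (simp add: binaryset_def)
  moreover have "(\<integral>\<^sup>+\<omega>. ennreal (exp (\<theta> * points_in A \<omega>)) * ennreal (exp (\<theta> * points_in (B - A) \<omega>)) \<partial>M)
      = (\<integral>\<^sup>+\<omega>. ennreal (exp (\<theta> * points_in B \<omega>)) \<partial>M)"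
    by (intro nn_integral_cong) (simp add: points_in_split exp_add distrib_left flip: ennreal_mult)
  moreover have "exp (measure \<Lambda> B * (exp \<theta> - 1))
      = exp (measure \<Lambda> A * (exp \<theta> - 1)) * exp (measure \<Lambda> (B - A) * (exp \<theta> - 1))"
    by (simp add: measure_split algebra_simps flip: exp_add)
  ultimately have "ennreal (exp (measure \<Lambda> A * (exp \<theta> - 1))) * (\<integral>\<^sup>+\<omega>. ennreal (exp (\<theta> * points_in (B - A) \<omega>)) \<partial>M)
      = ennreal (exp (measure \<Lambda> A * (exp \<theta> - 1))) * ennreal (exp (measure \<Lambda> (B - A) * (exp \<theta> - 1)))"
    using A B by (simp add: mgf_points_in_compact ennreal_mult)
  \<comment> \<open>Cancelling is legitimate in \<open>ennreal\<close> because the common factor is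
    a real exponential, neither \<open>0\<close> nor infinite.\<close>
  then show ?thesis
    by (simp add: ennreal_mult_cancel_left)
qed

text \<open>Additivity of the counts gives the mean in \<open>B - A\<close> as a difference; the
  mean in \<open>A\<close> can be cancelled because it is finite.\<close>

lemma mean_points_in_Diff:
  "(\<integral>\<^sup>+\<omega>. ennreal (points_in (B - A) \<omega>) \<partial>M) = ennreal (measure \<Lambda> (B - A))"
proof -
  have "ennreal (measure \<Lambda> A) + ennreal (measure \<Lambda> (B - A)) = (\<integral>\<^sup>+\<omega>. ennreal (points_in B \<omega>) \<partial>M)"
    using A B by (simp add: mean_points_in_compact measure_split flip: ennreal_plus) 
       (metis add.commute diff_add_cancel ennreal_plus measure_nonneg measure_split)
  also have "\<dots> = (\<integral>\<^sup>+\<omega>. ennreal (points_in A \<omega>) + ennreal (points_in (B - A) \<omega>) \<partial>M)"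
    by (intro nn_integral_cong) (simp add: points_in_split flip: ennreal_plus)
  also have "\<dots> = (\<integral>\<^sup>+\<omega>. ennreal (points_in A \<omega>) \<partial>M) + (\<integral>\<^sup>+\<omega>. ennreal (points_in (B - A) \<omega>) \<partial>M)"
    using A B by (intro nn_integral_add measurable_compose[OF measurable_points_in measurable_ennreal]) auto
  also have "\<dots> = ennreal (measure \<Lambda> A) + (\<integral>\<^sup>+\<omega>. ennreal (points_in (B - A) \<omega>) \<partial>M)"
    using A by (simp add: mean_points_in_compact)
  finally show ?thesis
    by (simp add: ennreal_add_left_cancel)
qed

end

section \<open>Sums over the process of a function that is constant on layers\<close>

context
  fixes A :: "nat \<Rightarrow> 'a set" and n :: nat and c :: "nat \<Rightarrow> real" and F :: "'a \<Rightarrow> real"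
  assumes A: "\<And>j. A j \<in> sets \<Lambda>" "\<And>j. compact (A j)" "mono A" and An: "A n = space \<Lambda>"
    and F: "\<And>j x. j \<le> n \<Longrightarrow> x \<in> disjointed A j \<Longrightarrow> F x = c j"
begin

lemma sets_disjointed: "disjointed A j \<in> sets \<Lambda>"
  using A(1) by (auto simp: disjointed_def)

lemma space_eq_UN_disjointed: "space \<Lambda> = (\<Union>j\<le>n. disjointed A j)"
proof -
  have "(\<Union>j\<le>n. disjointed A j) = (\<Union>j\<le>n. A j)"
    using finite_UN_disjointed_eq[of A "Suc n"] by (simp add: atLeast0LessThan lessThan_Suc_atMost)
  also have "\<dots> = A n"
    using A(3) by (auto dest: monoD)
  finally show ?thesis
    using An by simp
qed

lemma emeasure_disjointed_finite: "emeasure \<Lambda> (disjointed A j) < \<infinity>"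
  using pp A(1,2)[of j] emeasure_mono[OF disjointed_subset, of A j \<Lambda>]
  by (auto simp: poisson_process_def intro: le_less_trans)

text \<open>Since \<open>A n\<close> is the whole space and compact, \<open>\<Phi> \<omega>\<close>
  is finite. The left side is thus a genuine sum, not the default \<open>0\<close> of a sum over an
  infinite set.\<close>

lemma sum_points_layered:
  assumes \<omega>: "\<omega> \<in> space M"
  shows "(\<Sum>x\<in>\<Phi> \<omega>. F x) = (\<Sum>j\<le>n. c j * points_in (disjointed A j) \<omega>)"
proof -
  have fin: "finite (\<Phi> \<omega> \<inter> disjointed A j)" for j
    using \<omega> A disjointed_subset by (intro finite_points)
  have "\<Phi> \<omega> = (\<Union>j\<le>n. \<Phi> \<omega> \<inter> disjointed A j)"
    using pp \<omega> space_eq_UN_disjointed by (auto simp: poisson_process_def)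
  then have "(\<Sum>x\<in>\<Phi> \<omega>. F x) = (\<Sum>x\<in>(\<Union>j\<le>n. \<Phi> \<omega> \<inter> disjointed A j). F x)"
    by simp
  also have "\<dots> = (\<Sum>j\<le>n. \<Sum>x\<in>\<Phi> \<omega> \<inter> disjointed A j. F x)"
    using fin disjoint_family_disjointed[of A]
    by (intro sum.UNION_disjoint) (auto simp: disjoint_family_on_def)
  also have "\<dots> = (\<Sum>j\<le>n. c j * points_in (disjointed A j) \<omega>)"
  proof (intro sum.cong refl)
    fix j assume "j \<in> {..n}"
    then have "(\<Sum>x\<in>\<Phi> \<omega> \<inter> disjointed A j. F x) = (\<Sum>x\<in>\<Phi> \<omega> \<inter> disjointed A j. c j)"
      using F by (intro sum.cong) auto
    then show "(\<Sum>x\<in>\<Phi> \<omega> \<inter> disjointed A j. F x) = c j * points_in (disjointed A j) \<omega>"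
      using points_in_eq_card[OF \<omega> A(1,2) disjointed_subset] by simp
  qed
  finally show ?thesis .
qed

lemma measurable_sum_points[measurable]: "(\<lambda>\<omega>. \<Sum>x\<in>\<Phi> \<omega>. F x) \<in> borel_measurable M"
proof -
  have "(\<lambda>\<omega>. \<Sum>j\<le>n. c j * points_in (disjointed A j) \<omega>) \<in> borel_measurable M"
    by (intro borel_measurable_sum borel_measurable_times borel_measurable_const
        measurable_points_in sets_disjointed)
  then show ?thesis
    by (subst measurable_cong[OF sum_points_layered])
qed

lemma integral_layered: "(\<integral>x. F x \<partial>\<Lambda>) = (\<Sum>j\<le>n. c j * measure \<Lambda> (disjointed A j))"
proof -
  have "(\<integral>x. F x \<partial>\<Lambda>) = (\<integral>x. (\<Sum>j\<le>n. c j * indicator (disjointed A j) x) \<partial>\<Lambda>)"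
  proof (rule Bochner_Integration.integral_cong[OF refl])
    fix x assume "x \<in> space \<Lambda>"
    then obtain k where k: "k \<le> n" "x \<in> disjointed A k"
      using space_eq_UN_disjointed by auto
    \<comment> \<open>Layers are disjoint, so only the indicator of the layer containing
      \<open>x\<close> survives.\<close>
    have "x \<in> disjointed A j \<longleftrightarrow> j = k" for j
      using k less_disjoint_disjointed[of j k A] less_disjoint_disjointed[of k j A]
      by (cases j k rule: linorder_cases) auto
    then have "(\<Sum>j\<le>n. c j * indicator (disjointed A j) x) = (\<Sum>j\<le>n. if j = k then c j else 0)"
      by (intro sum.cong) (simp_all add: indicator_def)
    with k F show "F x = (\<Sum>j\<le>n. c j * indicator (disjointed A j) x)"
      by simp
  qed
  also have "\<dots> = (\<Sum>j\<le>n. \<integral>x. c j * indicator (disjointed A j) x \<partial>\<Lambda>)"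
    using emeasure_disjointed_finite sets_disjointed
    by (intro Bochner_Integration.integral_sum integrable_mult_right integrable_real_indicator)
  also have "\<dots> = (\<Sum>j\<le>n. c j * measure \<Lambda> (disjointed A j))"
    using sets_disjointed sets.sets_into_space by (auto intro!: sum.cong simp: Int_absorb2)
  finally show ?thesis .
qed

text \<open>Layer \<open>0\<close> is the compact set \<open>A 0\<close>; by monotonicity every
  later layer is a difference of two consecutive compact sets.\<close>

lemma mean_points_in_disjointed:
  "(\<integral>\<^sup>+\<omega>. ennreal (points_in (disjointed A j) \<omega>) \<partial>M) = ennreal (measure \<Lambda> (disjointed A j))"
proof (cases j)
  case 0
  show ?thesis
    unfolding 0 disjointed_0 by (rule mean_points_in_compact[OF A(1,2)])
next
  case (Suc i)
  have "A i \<subseteq> A (Suc i)"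
    using A(3) by (simp add: monoD)
  then show ?thesis
    unfolding Suc disjointed_mono[OF A(3)] by (rule mean_points_in_Diff[OF A(1,2) A(1,2)])
qed

lemma mgf_points_in_disjointed:
  "(\<integral>\<^sup>+\<omega>. ennreal (exp (\<theta> * points_in (disjointed A j) \<omega>)) \<partial>M)
     = ennreal (exp (measure \<Lambda> (disjointed A j) * (exp \<theta> - 1)))"
proof (cases j)
  case 0
  show ?thesis
    unfolding 0 disjointed_0 by (rule mgf_points_in_compact[OF A(1,2)])
next
  case (Suc i)
  have "A i \<subseteq> A (Suc i)"
    using A(3) by (simp add: monoD)
  then show ?thesis
    unfolding Suc disjointed_mono[OF A(3)] by (rule mgf_points_in_Diff[OF A(1,2) A(1,2)])
qed

text \<open>Campbell's formula for layered functions: both sides are the sum of \<open>c j\<close>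
  times the mass of layer \<open>j\<close>.\<close>

lemma expectation_sum_points:
  "expectation (\<lambda>\<omega>. \<Sum>x\<in>\<Phi> \<omega>. F x) = (\<integral>x. F x \<partial>\<Lambda>)"
proof -
  have i: "integrable M (points_in (disjointed A j))" for j
    using sets_disjointed mean_points_in_disjointed by (intro integrableI_nn_integral_finite) auto
  have e: "expectation (points_in (disjointed A j)) = measure \<Lambda> (disjointed A j)" for j
    using sets_disjointed mean_points_in_disjointed by (simp add: integral_eq_nn_integral)
  have "expectation (\<lambda>\<omega>. \<Sum>x\<in>\<Phi> \<omega>. F x) = expectation (\<lambda>\<omega>. \<Sum>j\<le>n. c j * points_in (disjointed A j) \<omega>)"
    by (intro Bochner_Integration.integral_cong refl sum_points_layered)
  also have "\<dots> = (\<Sum>j\<le>n. c j * measure \<Lambda> (disjointed A j))"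
    using i e by simp
  finally show ?thesis
    by (simp add: integral_layered)
qed

text \<open>The counts in the disjoint layers are independent, so the transform is a product; the
  weight \<open>c j\<close> turns the parameter \<theta> into \<open>\<theta> * c j\<close> in layer
  \<open>j\<close>.\<close>

lemma mgf_sum_points:
  "(\<integral>\<^sup>+\<omega>. ennreal (exp (\<theta> * (\<Sum>x\<in>\<Phi> \<omega>. F x))) \<partial>M)
     = ennreal (exp (\<Sum>j\<le>n. measure \<Lambda> (disjointed A j) * (exp (\<theta> * c j) - 1)))"
proof -
  have "indep_vars (\<lambda>_. borel) (\<lambda>j \<omega>. ennreal (exp (\<theta> * c j * points_in (disjointed A j) \<omega>))) {..n}"
    using sets_disjointed disjoint_family_disjointed by (intro indep_vars_points_in) auto
  from indep_vars_nn_integral[OF _ this]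
  have "(\<integral>\<^sup>+\<omega>. (\<Prod>j\<le>n. ennreal (exp (\<theta> * c j * points_in (disjointed A j) \<omega>))) \<partial>M)
      = (\<Prod>j\<le>n. ennreal (exp (measure \<Lambda> (disjointed A j) * (exp (\<theta> * c j) - 1))))"
    by (simp add: mgf_points_in_disjointed)
  also have "\<dots> = ennreal (exp (\<Sum>j\<le>n. measure \<Lambda> (disjointed A j) * (exp (\<theta> * c j) - 1)))"
    by (simp add: prod_ennreal exp_sum)
  also have "(\<integral>\<^sup>+\<omega>. (\<Prod>j\<le>n. ennreal (exp (\<theta> * c j * points_in (disjointed A j) \<omega>))) \<partial>M)
      = (\<integral>\<^sup>+\<omega>. ennreal (exp (\<theta> * (\<Sum>x\<in>\<Phi> \<omega>. F x))) \<partial>M)"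
    by (intro nn_integral_cong)
       (simp add: sum_points_layered prod_ennreal sum_distrib_left mult.assoc flip: exp_sum)
  finally show ?thesis .
qed

end

end

section \<open>The radii at which the resource demand jumps\<close>

text \<open>The radius is the distance at which the ratio equals \<open>j\<close>; monotone
  functions are inverted one at a time, with \<open>q\<close> the signal-to-interference ratio and
  \<open>T\<close> its threshold.\<close>

lemma ratio_le_iff_le_radius:
  fixes P I W C\<^sub>0 \<gamma> s j :: real
  assumes pos: "P > 0" "I > 0" "W > 0" "C\<^sub>0 > 0" "\<gamma> > 0" "s > 0" "j > 0"
  shows "C\<^sub>0 / (W * log 2 (1 + P / (I * s powr \<gamma>))) \<le> j
    \<longleftrightarrow> s \<le> (P / (I * (2 powr (C\<^sub>0 / (j * W)) - 1))) powr (1 / \<gamma>)"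
proof -
  define q where "q = P / (I * s powr \<gamma>)"
  define T where "T = 2 powr (C\<^sub>0 / (j * W)) - 1"
  have q: "q > 0" and T: "T > 0"
    using pos by (simp_all add: q_def T_def)
  have "C\<^sub>0 / (W * log 2 (1 + q)) \<le> j \<longleftrightarrow> C\<^sub>0 / (j * W) \<le> log 2 (1 + q)"
    using pos q by (simp add: field_simps)
  also have "\<dots> \<longleftrightarrow> T \<le> q"
    using q by (simp add: le_log_iff T_def algebra_simps)
  also have "\<dots> \<longleftrightarrow> s powr \<gamma> \<le> P / (I * T)"
    using pos T by (simp add: q_def field_simps)
  also have "\<dots> \<longleftrightarrow> s \<le> (P / (I * T)) powr (1 / \<gamma>)"
  proof -
    have "s powr \<gamma> \<le> P / (I * T) \<longleftrightarrow> (s powr \<gamma>) powr (1 / \<gamma>) \<le> (P / (I * T)) powr (1 / \<gamma>)"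
      using pos T powr_mono2[of "1 / \<gamma>" "s powr \<gamma>" "P / (I * T)"]
        powr_less_mono2[of "1 / \<gamma>" "P / (I * T)" "s powr \<gamma>"] by force
    then show ?thesis
      using pos by (simp add: powr_powr)
  qed
  finally show ?thesis
    by (simp add: q_def T_def)
qed

text \<open>The exponent of \<open>2\<close> decreases in \<open>j\<close>, while the power stays
  above \<open>1\<close>, so the denominator shrinks but remains positive.\<close>

lemma radius_strict_mono:
  fixes P I W C\<^sub>0 \<gamma> i j :: real
  assumes pos: "P > 0" "I > 0" "W > 0" "C\<^sub>0 > 0" "\<gamma> > 0" "0 < i" "i < j"
  shows "(P / (I * (2 powr (C\<^sub>0 / (i * W)) - 1))) powr (1 / \<gamma>)
    < (P / (I * (2 powr (C\<^sub>0 / (j * W)) - 1))) powr (1 / \<gamma>)"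
proof -
  define a b where "a = 2 powr (C\<^sub>0 / (i * W))" and "b = 2 powr (C\<^sub>0 / (j * W))"
  have "b < a"
    using pos by (simp add: a_def b_def divide_strict_left_mono)
  moreover have "1 < b"
    using pos by (simp add: b_def)
  ultimately show ?thesis
    unfolding a_def[symmetric] b_def[symmetric] using pos
    by (intro powr_less_mono2 divide_strict_left_mono mult_strict_left_mono) auto
qed

text \<open>The exact moments are \<open>m\<close> and \<open>v\<close>, with the outer ring cut at
  the cell boundary; they are shown to equal \<open>m'\<close> and \<open>v'\<close> if
  \<open>r N\<^sub>m\<^sub>a\<^sub>x = R\<close>. The tail bound is given for both pairs in every
  case. \<open>N 0\<close> is left arbitrary.\<close>

theorem mainTheorem2:
  fixes R \<rho> \<nu> C\<^sub>0 W P\<^sub>t K gbar I \<gamma> :: real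
    and M :: "'w measure"
    and \<Phi> :: "'w \<Rightarrow> (real ^ 2) set"
  assumes pos: "R > 0" "\<rho> > 0" "\<nu> > 0" "C\<^sub>0 > 0" "W > 0" "P\<^sub>t > 0" "K > 0" "gbar > 0" "I > 0" "\<gamma> > 0"
  defines "C \<equiv> cball (0 :: real ^ 2) R"
  defines "\<Lambda> \<equiv> density (restrict_space lborel C) (\<lambda>_. ennreal (\<rho> / \<nu>))"
  assumes \<Phi>: "poisson_process M \<Lambda> \<Phi>"
  fixes N :: "real ^ 2 \<Rightarrow> int" and N\<^sub>m\<^sub>a\<^sub>x :: nat
  assumes N: "\<And>x. x \<in> C - {0} \<Longrightarrow>
      N x = \<lceil>C\<^sub>0 / (W * log 2 (1 + P\<^sub>t * K * gbar / (I * norm x powr \<gamma>)))\<rceil>"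
    and N\<^sub>m\<^sub>a\<^sub>x: "\<And>x. norm x = R \<Longrightarrow> N x = int N\<^sub>m\<^sub>a\<^sub>x"
  fixes r :: "nat \<Rightarrow> real"
  assumes r0: "r 0 = 0"
    and rj: "\<And>j. j \<in> {1..N\<^sub>m\<^sub>a\<^sub>x} \<Longrightarrow>
      r j = (P\<^sub>t * K * gbar / (I * (2 powr (C\<^sub>0 / (real j * W)) - 1))) powr (1 / \<gamma>)"
  defines "m \<equiv> m_N \<rho> \<nu> N\<^sub>m\<^sub>a\<^sub>x (capped R r)"
    and "v \<equiv> v_N \<rho> \<nu> N\<^sub>m\<^sub>a\<^sub>x (capped R r)"
    and "m' \<equiv> m_N \<rho> \<nu> N\<^sub>m\<^sub>a\<^sub>x r"
    and "v' \<equiv> v_N \<rho> \<nu> N\<^sub>m\<^sub>a\<^sub>x r"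
  shows "(\<forall>x\<in>C - {0}. \<forall>y\<in>C - {0}. norm x \<le> norm y \<longrightarrow> N x \<le> N y)
    \<and> (\<forall>j\<in>{1..N\<^sub>m\<^sub>a\<^sub>x}. r (j - 1) < r j)
    \<and> r (N\<^sub>m\<^sub>a\<^sub>x - 1) < R \<and> R \<le> r N\<^sub>m\<^sub>a\<^sub>x
    \<and> (\<forall>x\<in>C. \<forall>j\<in>{1..N\<^sub>m\<^sub>a\<^sub>x}. r (j - 1) < norm x \<and> norm x \<le> r j \<longrightarrow> N x = int j)
    \<and> (\<integral>\<omega>. (\<Sum>x\<in>\<Phi> \<omega>. real_of_int (N x)) \<partial>M) = (\<integral>x. real_of_int (N x) \<partial>\<Lambda>)
    \<and> (\<integral>x. real_of_int (N x) \<partial>\<Lambda>) = m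
    \<and> (\<integral>x. (real_of_int (N x))\<^sup>2 \<partial>\<Lambda>) = v
    \<and> (r N\<^sub>m\<^sub>a\<^sub>x = R \<longrightarrow>
        (\<integral>x. real_of_int (N x) \<partial>\<Lambda>) = m' \<and> (\<integral>x. (real_of_int (N x))\<^sup>2 \<partial>\<Lambda>) = v')
    \<and> (\<forall>\<alpha>\<ge>1. measure M {\<omega>\<in>space M. (\<Sum>x\<in>\<Phi> \<omega>. real_of_int (N x)) \<ge> \<alpha> * m}
          \<le> deviation_bound m v (real N\<^sub>m\<^sub>a\<^sub>x) \<alpha>)
    \<and> (\<forall>\<alpha>\<ge>1. measure M {\<omega>\<in>space M. (\<Sum>x\<in>\<Phi> \<omega>. real_of_int (N x)) \<ge> \<alpha> * m'}
          \<le> deviation_bound m' v' (real N\<^sub>m\<^sub>a\<^sub>x) \<alpha>)"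
proof -

  \<comment> \<open>Monotonicity and ring values of \<open>N\<close>\<close>
  let ?n = "N\<^sub>m\<^sub>a\<^sub>x"
  \<comment> \<open>\<open>r\<close> is prescribed only up to \<open>?n\<close>; \<open>a\<close>
    extends it to all indices, so that \<open>N_le_iff\<close> can be used at
    \<open>nat (N y)\<close> before this is known to be at most \<open>?n\<close>.\<close>
  define a where "a j = (if j = 0 then 0 else (P\<^sub>t * K * gbar / (I * (2 powr (C\<^sub>0 / (real j * W)) - 1))) powr (1 / \<gamma>))" for j :: nat
  have PKg: "P\<^sub>t * K * gbar > 0"
    using pos by simp
  have r: "r j = a j" if "j \<le> ?n" for j
    using that r0 rj[of j] by (cases "j = 0") (auto simp: a_def)
  have a_strict: "a i < a j" if "i < j" for i j
    using radius_strict_mono[OF PKg pos(9,5,4,10), of "real i" "real j"] that pos PKg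
    by (auto simp: a_def)
  have a_nonneg: "a j \<ge> 0" for j
    by (simp add: a_def)
  have N_le_iff: "N x \<le> int j \<longleftrightarrow> norm x \<le> a j" if "x \<in> C - {0}" "j > 0" for x j
    using ratio_le_iff_le_radius[OF PKg pos(9,5,4,10), of "norm x" "real j"] that
    by (simp add: N a_def ceiling_le_iff)
  have N_pos: "N x > 0" if "x \<in> C - {0}" for x
  proof -
    have "P\<^sub>t * K * gbar / (I * norm x powr \<gamma>) > 0"
      using that pos by (intro divide_pos_pos mult_pos_pos) auto
    then have "log 2 (1 + P\<^sub>t * K * gbar / (I * norm x powr \<gamma>)) > 0"
      by simp
    then show ?thesis
      using that pos by (simp add: N)
  qed
  \<comment> \<open>A boundary point gives access to the hypothesis on
    \<open>N\<^sub>m\<^sub>a\<^sub>x\<close>: \<open>N z\<close> is at most \<open>?n\<close> but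
    not at most \<open>?n - 1\<close>, which places \<open>R\<close> between the last two
    radii.\<close>
  obtain z :: "real ^ 2" where z: "norm z = R"
    using vector_choose_size[of R] pos by auto
  have zC: "z \<in> C - {0}" and Nz: "N z = int ?n"
    using z pos N\<^sub>m\<^sub>a\<^sub>x by (auto simp: C_def)
  have n: "?n > 0"
    using N_pos[OF zC] Nz by simp
  have R_le: "R \<le> r ?n"
    using N_le_iff[OF zC n] Nz z r by simp
  have less_R: "r (?n - 1) < R"
  proof (cases "?n - 1 = 0")
    case False
    then show ?thesis
      using N_le_iff[OF zC, of "?n - 1"] Nz z r by simp
  qed (use r0 pos in simp)
  have r_strict: "r i < r j" if "i < j" "j \<le> ?n" for i j
    using that a_strict r by simp
  have r_nonneg: "r j \<ge> 0" if "j \<le> ?n" for j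
    using that a_nonneg r by simp
  have N_mono: "N x \<le> N y" if x: "x \<in> C - {0}" and y: "y \<in> C - {0}" and le: "norm x \<le> norm y" for x y
  proof -
    have "norm y \<le> a (nat (N y))"
      using N_le_iff[OF y, of "nat (N y)"] N_pos[OF y] by simp
    then show ?thesis
      using N_le_iff[OF x, of "nat (N y)"] N_pos[OF y] le by simp
  qed
  have N_ring: "N x = int j" if x: "x \<in> C" and j: "j \<in> {1..?n}" and lt: "r (j - 1) < norm x" and le: "norm x \<le> r j" for x j
  proof -
    have "norm x > 0"
      using j by (intro order.strict_trans1[OF r_nonneg lt]) auto
    with x have x': "x \<in> C - {0}"
      by auto
    have "N x \<le> int j"
      using N_le_iff[OF x', of j] j le r by auto
    moreover have "int j \<le> N x"
    \<comment> \<open>For \<open>j = 1\<close> the index \<open>j - 1\<close> is outside the range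
      of \<open>N_le_iff\<close>, and positivity of \<open>N x\<close> takes its place.\<close>
    proof (cases "j = 1")
      case False
      then show ?thesis
        using N_le_iff[OF x', of "j - 1"] j lt r[of "j - 1"] by auto
    qed (use N_pos[OF x'] in simp)
    ultimately show ?thesis
      by simp
  qed

  \<comment> \<open>Rings of the cell and their masses\<close>
  let ?cap = "capped R r"
  \<comment> \<open>Truncating the index at \<open>?n\<close> makes \<open>A\<close> a monotone
    sequence on all naturals that is constantly the cell from \<open>?n\<close> on.\<close>
  define A where "A j = cball (0 :: real ^ 2) (?cap (min j ?n))" for j
  \<comment> \<open>Layer \<open>0\<close> is the single point \<open>0\<close>, where the value of
    \<open>N\<close> is unknown; its mass is \<open>0\<close> by \<open>l0\<close>, so it
    contributes nothing to the sums below.\<close>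
  define c where "c j = (if j = 0 then real_of_int (N 0) else real j)" for j
  have cap0: "?cap 0 = 0"
    using pos r0 by (simp add: capped_def)
  have capn: "?cap ?n = R"
    using R_le by (simp add: capped_def)
  have r_less_R: "r j < R" if "j < ?n" for j
  proof (cases "j = ?n - 1")
    case False
    with that have "r j < r (?n - 1)"
      by (intro r_strict) auto
    with less_R show ?thesis
      by simp
  qed (use less_R in simp)
  have cap_r: "?cap j = r j" if "j < ?n" for j
    using r_less_R[OF that] by (simp add: capped_def)
  have cap_strict: "?cap i < ?cap j" if "i < j" "j \<le> ?n" for i j
  proof -
    have "r i < r j" "r i < R"
      using that r_strict[of i j] r_less_R[of i] by auto
    then show ?thesis
      by (simp add: capped_def)
  qed
  have cap_mono: "?cap i \<le> ?cap j" if "i \<le> j" "j \<le> ?n" for i j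
    using cap_strict[of i j] that by (cases "i = j") auto
  have cap_nonneg: "?cap j \<ge> 0" if "j \<le> ?n" for j
    using cap_mono[of 0 j] that cap0 by simp
  have cap_R: "?cap j \<le> R" for j
    by (simp add: capped_def)
  have space: "space \<Lambda> = C"
    by (simp add: \<Lambda>_def space_restrict_space)
  have sets: "B \<in> sets \<Lambda> \<longleftrightarrow> B \<in> sets borel \<and> B \<subseteq> C" for B
    by (subst \<Lambda>_def) (auto simp: C_def sets_restrict_space_iff)
  have meas: "measure \<Lambda> (cball 0 s) = pi * \<rho> / \<nu> * s\<^sup>2" if s: "0 \<le> s" "s \<le> R" for s
  proof -
    have sub: "cball 0 s \<subseteq> C"
      using s by (auto simp: C_def)
    have "emeasure \<Lambda> (cball 0 s) = ennreal (\<rho> / \<nu>) * emeasure (restrict_space lborel C) (cball 0 s)"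
      using sub unfolding \<Lambda>_def
      by (subst emeasure_density_const) (auto simp: C_def sets_restrict_space_iff)
    also have "emeasure (restrict_space lborel C) (cball 0 s) = emeasure lborel (cball (0 :: real ^ 2) s)"
      using sub by (subst emeasure_restrict_space) (auto simp: C_def)
    also have "\<dots> = ennreal (pi * s\<^sup>2)"
      using s by (simp add: emeasure_cball unit_ball_vol_2)
    finally show ?thesis
      using pos by (simp add: measure_def flip: ennreal_mult)
  qed
  have A_sets: "A j \<in> sets \<Lambda>" for j
    using cap_R by (simp add: sets A_def C_def subset_cball)
  have A_compact: "compact (A j)" for j
    by (simp add: A_def)
  have A_mono: "mono A"
    by (intro monoI) (auto simp: A_def intro!: subset_cball cap_mono)
  have A_n: "A ?n = space \<Lambda>"
    by (simp add: A_def capn space C_def)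
  have ringD: "x \<in> C \<and> r (j - 1) < norm x \<and> norm x \<le> r j" if "x \<in> disjointed A j" "j \<in> {1..?n}" for x j
  proof -
    obtain i where i: "j = Suc i" "i < ?n"
      using \<open>j \<in> {1..?n}\<close> by (cases j) auto
    then have "?cap i < norm x" "norm x \<le> ?cap j"
      using that(1) by (auto simp: disjointed_mono[OF A_mono] A_def min_def not_le)
    then show ?thesis
      using cap_r[OF i(2)] i(1) by (auto simp: capped_def C_def)
  qed
  have N_layer: "real_of_int (N x) = c j" if "j \<le> ?n" "x \<in> disjointed A j" for j x
  proof (cases j)
    case 0
    then show ?thesis
      using that cap0 by (auto simp: A_def c_def)
  next
    case (Suc i)
    then show ?thesis
      using ringD[OF that(2)] N_ring[of x j] that(1) by (auto simp: c_def)
  qed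
  note layers = \<Phi> A_sets A_compact A_mono A_n
  define l where "l j = measure \<Lambda> (disjointed A j)" for j
  have l0: "l 0 = 0"
    using meas[of 0] pos by (simp add: l_def A_def cap0)
  have l_eq: "l j = pi * \<rho> / \<nu> * ((?cap j)\<^sup>2 - (?cap (j - 1))\<^sup>2)" if j: "j \<in> {1..?n}" for j
  proof -
    obtain i where i: "j = Suc i" "i < ?n"
      using j by (cases j) auto
    have "A i \<subseteq> A j"
      using A_mono i by (simp add: monoD)
    then have "l j = measure \<Lambda> (A j) - measure \<Lambda> (A i)"
      using measure_split[OF \<Phi> A_sets A_compact A_sets A_compact]
      by (simp add: l_def i disjointed_mono[OF A_mono])
    then show ?thesis
      using i cap_nonneg cap_R by (simp add: A_def meas min_def algebra_simps)
  qed
  have sum0: "(\<Sum>j\<le>?n. f j * l j) = (\<Sum>j=1..?n. f j * l j)" for f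
  proof -
    have "{..?n} = insert 0 {1..?n}"
      by auto
    then show ?thesis
      by (simp add: l0)
  qed

  \<comment> \<open>Moments of \<open>N\<close> and the tail bound\<close>
  have m_eq: "m_N \<rho> \<nu> ?n s = (\<Sum>j=1..?n. real j * (pi * \<rho> / \<nu> * ((s j)\<^sup>2 - (s (j - 1))\<^sup>2)))"
    and v_eq: "v_N \<rho> \<nu> ?n s = (\<Sum>j=1..?n. (real j)\<^sup>2 * (pi * \<rho> / \<nu> * ((s j)\<^sup>2 - (s (j - 1))\<^sup>2)))" for s
    by (simp_all add: m_N_def v_N_def sum_distrib_left mult_ac)
  have int_N: "(\<integral>x. real_of_int (N x) \<partial>\<Lambda>) = m"
  proof -
    have "(\<integral>x. real_of_int (N x) \<partial>\<Lambda>) = (\<Sum>j\<le>?n. c j * l j)"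
      unfolding l_def by (rule integral_layered[OF layers N_layer])
    also have "\<dots> = m"
      unfolding sum0 m_def m_eq by (intro sum.cong) (auto simp: l_eq c_def)
    finally show ?thesis .
  qed
  have int_N2: "(\<integral>x. (real_of_int (N x))\<^sup>2 \<partial>\<Lambda>) = v"
  proof -
    have "(\<integral>x. (real_of_int (N x))\<^sup>2 \<partial>\<Lambda>) = (\<Sum>j\<le>?n. (c j)\<^sup>2 * l j)"
      unfolding l_def by (rule integral_layered[OF layers]) (simp add: N_layer)
    also have "\<dots> = v"
      unfolding sum0 v_def v_eq by (intro sum.cong) (auto simp: l_eq c_def)
    finally show ?thesis .
  qed
  have expectation: "(\<integral>\<omega>. (\<Sum>x\<in>\<Phi> \<omega>. real_of_int (N x)) \<partial>M) = (\<integral>x. real_of_int (N x) \<partial>\<Lambda>)"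
    by (rule expectation_sum_points[OF layers N_layer])
  \<comment> \<open>stated for radii \<open>s\<close>, to be used with both the capped and the uncapped ones\<close>
  have tail: "measure M {\<omega>\<in>space M. (\<Sum>x\<in>\<Phi> \<omega>. real_of_int (N x)) \<ge> \<alpha> * m_N \<rho> \<nu> ?n s}
      \<le> deviation_bound (m_N \<rho> \<nu> ?n s) (v_N \<rho> \<nu> ?n s) (real ?n) \<alpha>"
    if \<alpha>: "\<alpha> \<ge> 1"
      and s: "\<And>j. j \<in> {1..?n} \<Longrightarrow> l j \<le> pi * \<rho> / \<nu> * ((s j)\<^sup>2 - (s (j - 1))\<^sup>2)" for \<alpha> s
  proof -
    define l' where "l' j = pi * \<rho> / \<nu> * ((s j)\<^sup>2 - (s (j - 1))\<^sup>2)" for j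
    have l_pos: "l j > 0" if j: "j \<in> {1..?n}" for j
    proof -
      have "(?cap (j - 1))\<^sup>2 < (?cap j)\<^sup>2"
        using j cap_strict[of "j - 1" j] cap_nonneg[of "j - 1"] by (intro power_strict_mono) auto
      then show ?thesis
        using pos by (simp add: l_eq[OF j])
    qed
    have l'_pos: "l' j > 0" if "j \<in> {1..?n}" for j
      using l_pos[OF that] s[OF that] by (simp add: l'_def)
    interpret prob_space M
      using \<Phi> by (simp add: poisson_process_def)
    have mgf: "(\<integral>\<^sup>+\<omega>. ennreal (exp (\<theta> * (\<Sum>x\<in>\<Phi> \<omega>. real_of_int (N x)))) \<partial>M)
        \<le> ennreal (exp (\<Sum>j=1..?n. l' j * (exp (\<theta> * real j) - 1)))" if \<theta>: "\<theta> \<ge> 0" for \<theta>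
    proof -
      have "(\<integral>\<^sup>+\<omega>. ennreal (exp (\<theta> * (\<Sum>x\<in>\<Phi> \<omega>. real_of_int (N x)))) \<partial>M)
          = ennreal (exp (\<Sum>j\<le>?n. l j * (exp (\<theta> * c j) - 1)))"
        unfolding l_def by (rule mgf_sum_points[OF layers N_layer])
      also have "(\<Sum>j\<le>?n. l j * (exp (\<theta> * c j) - 1)) = (\<Sum>j=1..?n. l j * (exp (\<theta> * real j) - 1))"
        using sum0[of "\<lambda>j. exp (\<theta> * c j) - 1"] by (simp add: mult.commute c_def)
      \<comment> \<open>For \<theta> \<ge> 0 every factor \<open>exp (\<theta> * real j) - 1\<close>
        is nonnegative, so replacing the masses \<open>l j\<close> by the larger \<open>l' j\<close>
        increases the sum.\<close>
      also have "ennreal (exp \<dots>) \<le> ennreal (exp (\<Sum>j=1..?n. l' j * (exp (\<theta> * real j) - 1)))"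
        using s[folded l'_def] \<theta>
        by (intro ennreal_leI exp_le_cancel_iff[THEN iffD2] sum_mono mult_right_mono) auto
      finally show ?thesis .
    qed
    show ?thesis
    proof (rule bennett_tail[OF _ mgf])
      show "(\<lambda>\<omega>. \<Sum>x\<in>\<Phi> \<omega>. real_of_int (N x)) \<in> borel_measurable M"
        by (rule measurable_sum_points[OF layers N_layer])
      show m: "m_N \<rho> \<nu> ?n s = (\<Sum>j=1..?n. real j * l' j)"
        and v: "v_N \<rho> \<nu> ?n s = (\<Sum>j=1..?n. (real j)\<^sup>2 * l' j)"
        by (simp_all only: m_eq v_eq l'_def)
      show "m_N \<rho> \<nu> ?n s > 0" "v_N \<rho> \<nu> ?n s > 0"
        unfolding m v using n l'_pos by (auto intro!: sum_pos)
    qed (use l'_pos n \<alpha> in \<open>auto intro: less_imp_le\<close>)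
  qed
  \<comment> \<open>Inner radii lie inside the cell and are unaffected by the cap; the outer radius
    can only grow when the cap is removed.\<close>
  have uncapped: "l j \<le> pi * \<rho> / \<nu> * ((r j)\<^sup>2 - (r (j - 1))\<^sup>2)" if j: "j \<in> {1..?n}" for j
  proof -
    have "(?cap j)\<^sup>2 \<le> (r j)\<^sup>2"
      using cap_nonneg[of j] j by (intro power_mono) (auto simp: capped_def)
    moreover have "?cap (j - 1) = r (j - 1)"
      using j by (intro cap_r) auto
    ultimately show ?thesis
      unfolding l_eq[OF j] using pos by (intro mult_left_mono) auto
  qed
  have eq: "m = m' \<and> v = v'" if "r ?n = R"
  proof -
    have "?cap j = r j" if "j \<le> ?n" for j
      using that cap_r[of j] capn \<open>r ?n = R\<close> by (cases "j = ?n") auto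
    then show ?thesis
      unfolding m_def m'_def v_def v'_def m_eq v_eq by (auto intro!: sum.cong)
  qed
  show ?thesis
    using N_mono N_ring less_R R_le r_strict expectation int_N int_N2 eq
      tail[of _ ?cap] tail[of _ r] l_eq uncapped
    unfolding m_def v_def m'_def v'_def
    by (intro conjI ballI impI allI) (auto intro!: order_eq_refl)
qed

end
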